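(* Let $G$ be a finite simple connected graph with at least one edge and minimal vertex covers $W_1,\dots,W_m$, and let $s\ge 0$. Then the $s$-order principal component of $G$ equals $$\mathcal{V}(\langle\mathcal{J}_s(W_1)\rangle)\cup\cdots\cup\mathcal{V}(\langle\mathcal{J}_s(W_m)\rangle)\subseteq\mathbb{A}^{n(s+1)}_k.$$
   Context: $k$ is an algebraically closed field, $R=k[x_1,\dots,x_n]$ with the vertices of $G$ identified with the variables, $I(G)=\langle x_ix_j : \{x_i,x_j\}\in E(G)\rangle$ the edge ideal, and $X=\mathcal{V}(I(G))\subseteq\mathbb{A}^n_k$. $\mathcal{J}_s(R)=k[x_i^{(l)} : 1\le i\le n,\ 0\le l\le s]$, the coordinate ring of $\mathbb{A}^{n(s+1)}_k$. For $I=\langle f_1,\dots,f_r\rangle$, write $f_m(x_1^{(0)}+x_1^{(1)}t+\cdots+x_1^{(s)}t^s,\dots)\equiv\sum_{l=0}^s\alpha_m^{(l)}t^l\pmod{t^{s+1}}$ and set $\mathcal{J}_s(I)=\langle\alpha_m^{(l)}\rangle$; the jet scheme is $\mathcal{J}_s(X)=\mathcal{V}(\mathcal{J}_s(I(G)))\subseteq\mathbb{A}^{n(s+1)}_k$. The projection $\pi_s:\mathcal{J}_s(X)\to X$ sends a point to its coordinates $(x_1^{(0)},\dots,x_n^{(0)})$; for an open $U\subseteq X$, $\mathcal{J}_s(U)=\pi_s^{-1}(U)$. Let $X_{smooth}$ be the set of smooth points of $X$. The $s$-order principal component of $G$ is the Zariski closure of $\mathcal{J}_s(X_{smooth})$ in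 $\mathbb{A}^{n(s+1)}_k$. For $W\subseteq V(G)$, $\mathcal{J}_s(W)=\{x^{(j)} : x\in W,\ 0\le j\le s\}$. A minimal vertex cover is an inclusion-minimal set of vertices meeting every edge. *)

theory Defs
  imports "HOL-Computational_Algebra.Polynomial" "HOL-Library.Poly_Mapping"
          "HOL-Library.Extended_Nat" "HOL-Library.Function_Algebras"
begin

type_synonym ('x, 'k) mpoly = "('x \<Rightarrow>\<^sub>0 nat) \<Rightarrow>\<^sub>0 'k"

definition mpeval :: "('x, 'k::comm_semiring_1) mpoly \<Rightarrow> ('x \<Rightarrow> 'k) \<Rightarrow> 'k" where
  "mpeval f a = (\<Sum>(m::'x \<Rightarrow>\<^sub>0 nat)\<in>Poly_Mapping.keys f. Poly_Mapping.lookup f m * (\<Prod>v\<in>Poly_Mapping.keys m. a v ^ Poly_Mapping.lookup m v))"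

definition mpdiff :: "('x, 'k::comm_ring_1) mpoly \<Rightarrow> ('x \<Rightarrow> 'k) \<Rightarrow> ('x \<Rightarrow> 'k) \<Rightarrow> 'k" where
  "mpdiff f a w = (\<Sum>(m::'x \<Rightarrow>\<^sub>0 nat)\<in>Poly_Mapping.keys f. Poly_Mapping.lookup f m *
      (\<Sum>u\<in>Poly_Mapping.keys m. of_nat (Poly_Mapping.lookup m u) * a u ^ (Poly_Mapping.lookup m u - 1) * w u *
                   (\<Prod>v\<in>Poly_Mapping.keys m - {u}. a v ^ Poly_Mapping.lookup m v)))"

definition zset :: "('x, 'k::comm_semiring_1) mpoly set \<Rightarrow> ('x \<Rightarrow> 'k) set" where
  "zset F = {a. \<forall>f\<in>F. mpeval f a = 0}"

definition vanish :: "('x \<Rightarrow> 'k::comm_semiring_1) set \<Rightarrow> ('x, 'k) mpoly set" where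
  "vanish S = {f. \<forall>a\<in>S. mpeval f a = 0}"

definition zclosed :: "('x \<Rightarrow> 'k::comm_semiring_1) set \<Rightarrow> bool" where
  "zclosed Y \<longleftrightarrow> (\<exists>F. Y = zset F)"

definition zclosure :: "('x \<Rightarrow> 'k::comm_semiring_1) set \<Rightarrow> ('x \<Rightarrow> 'k) set" where
  "zclosure S = zset (vanish S)"

definition zirreducible :: "('x \<Rightarrow> 'k::comm_semiring_1) set \<Rightarrow> bool" where
  "zirreducible Y \<longleftrightarrow> zclosed Y \<and> Y \<noteq> {} \<and>
     (\<forall>Y1 Y2. zclosed Y1 \<and> zclosed Y2 \<and> Y \<subseteq> Y1 \<union> Y2 \<longrightarrow> Y \<subseteq> Y1 \<or> Y \<subseteq> Y2)"

definition zdim :: "('x \<Rightarrow> 'k::comm_semiring_1) set \<Rightarrow> enat" where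
  "zdim Z = Sup {enat n | n. \<exists>C :: nat \<Rightarrow> ('x \<Rightarrow> 'k) set.
      (\<forall>i\<le>n. zirreducible (C i) \<and> C i \<subseteq> Z) \<and> (\<forall>i<n. C i \<subset> C (Suc i))}"

definition zcomponent :: "('x \<Rightarrow> 'k::comm_semiring_1) set \<Rightarrow> ('x \<Rightarrow> 'k) set \<Rightarrow> bool" where
  "zcomponent X Y \<longleftrightarrow> zirreducible Y \<and> Y \<subseteq> X \<and>
     (\<forall>Y'. zirreducible Y' \<and> Y \<subseteq> Y' \<and> Y' \<subseteq> X \<longrightarrow> Y' = Y)"

definition local_dim :: "('x \<Rightarrow> 'k::comm_semiring_1) set \<Rightarrow> ('x \<Rightarrow> 'k) \<Rightarrow> enat" where
  "local_dim X p = Sup {zdim Y | Y. zcomponent X Y \<and> p \<in> Y}"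

definition tangent_space :: "('x \<Rightarrow> 'k::comm_ring_1) set \<Rightarrow> ('x \<Rightarrow> 'k) \<Rightarrow> ('x \<Rightarrow> 'k) set" where
  "tangent_space X p = {w. \<forall>f\<in>vanish X. mpdiff f p w = 0}"

definition smooth_points :: "('x \<Rightarrow> 'k::field) set \<Rightarrow> ('x \<Rightarrow> 'k) set" where
  "smooth_points X = {p \<in> X.
     enat (vector_space.dim (\<lambda>c (w::'x \<Rightarrow> 'k) v. c * w v) (tangent_space X p)) = local_dim X p}"

text \<open>Jet variables x_i^(l) are indexed by pairs (i, l); a point of A^{n(s+1)} is a
function on 'v \<times> nat vanishing at all (i, l) with l > s.\<close>
definition jet_space :: "nat \<Rightarrow> ('v \<times> nat \<Rightarrow> 'k::zero) set" where
  "jet_space s = {p. \<forall>i l. s < l \<longrightarrow> p (i, l) = 0}"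

definition jet_coeff :: "('v, 'k::comm_ring_1) mpoly \<Rightarrow> nat \<Rightarrow> nat \<Rightarrow> ('v \<times> nat \<Rightarrow> 'k) \<Rightarrow> 'k" where
  "jet_coeff f s l p = coeff (mpeval (Poly_Mapping.map (\<lambda>c. [:c:]) f)
                                    (\<lambda>i. \<Sum>a\<le>s. monom (p (i, a)) a)) l"

text \<open>J_s(X) = V(J_s(I)) for I generated by F.\<close>
definition jet_scheme :: "('v, 'k::comm_ring_1) mpoly set \<Rightarrow> nat \<Rightarrow> ('v \<times> nat \<Rightarrow> 'k) set" where
  "jet_scheme F s = {p \<in> jet_space s. \<forall>f\<in>F. \<forall>l\<le>s. jet_coeff f s l p = 0}"

definition jet_proj :: "('v \<times> nat \<Rightarrow> 'k) \<Rightarrow> ('v \<Rightarrow> 'k)" where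
  "jet_proj p = (\<lambda>i. p (i, 0))"

text \<open>Finite simple graph on vertex type 'v (vertex set = UNIV) with edge relation E.\<close>
definition simple_graph :: "('v \<Rightarrow> 'v \<Rightarrow> bool) \<Rightarrow> bool" where
  "simple_graph E \<longleftrightarrow> (\<forall>u v. E u v \<longleftrightarrow> E v u) \<and> (\<forall>u. \<not> E u u)"

definition graph_connected :: "('v \<Rightarrow> 'v \<Rightarrow> bool) \<Rightarrow> bool" where
  "graph_connected E \<longleftrightarrow> (\<forall>u v. E\<^sup>*\<^sup>* u v)"

definition edge_gens :: "('v \<Rightarrow> 'v \<Rightarrow> bool) \<Rightarrow> ('v, 'k::comm_semiring_1) mpoly set" where
  "edge_gens E = {Poly_Mapping.single (Poly_Mapping.single i 1 + Poly_Mapping.single j 1) 1 | i j. E i j}"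

definition vertex_cover :: "('v \<Rightarrow> 'v \<Rightarrow> bool) \<Rightarrow> 'v set \<Rightarrow> bool" where
  "vertex_cover E W \<longleftrightarrow> (\<forall>u v. E u v \<longrightarrow> u \<in> W \<or> v \<in> W)"

definition min_vertex_cover :: "('v \<Rightarrow> 'v \<Rightarrow> bool) \<Rightarrow> 'v set \<Rightarrow> bool" where
  "min_vertex_cover E W \<longleftrightarrow> vertex_cover E W \<and> (\<forall>W'. W' \<subset> W \<longrightarrow> \<not> vertex_cover E W')"

text \<open>s-order principal component: closure of J_s(X_smooth) = pi_s^{-1}(X_smooth).\<close>
definition principal_component :: "('v \<Rightarrow> 'v \<Rightarrow> bool) \<Rightarrow> nat \<Rightarrow> ('v \<times> nat \<Rightarrow> 'k::field) set" where
  "principal_component E s =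
     zclosure {p \<in> jet_scheme (edge_gens E) s. jet_proj p \<in> smooth_points (zset (edge_gens E))}"

definition jet_cover_set :: "'v set \<Rightarrow> nat \<Rightarrow> ('v \<times> nat \<Rightarrow> 'k::zero) set" where
  "jet_cover_set W s = {p \<in> jet_space s. \<forall>x\<in>W. \<forall>j\<le>s. p (x, j) = 0}"

end

theory Submission
  imports Defs "HOL-Library.FuncSet"
begin

text \<open>The components of \<open>X\<close> are the coordinate subspaces cut out by the minimal vertex covers. A point
  is smooth iff it lies on just one of them: the tangent space contains every component through the
  point, and no sum of two distinct components is as small as the largest one. Over a smooth point on
  the component of \<open>W\<close>, every \<open>u \<in> W\<close> has a neighbour whose jet is a unit, so the jet of \<open>u\<close> vanishes;
  conversely the generic jet supported off \<open>W\<close> lies over a smooth point.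

  That a coordinate subspace with \<open>n\<close> free coordinates has Krull dimension at most \<open>n\<close> is proved by
  counting. For a chain \<open>C 0 \<subset> \<dots> \<subset> C d\<close> of irreducible closed sets, choose \<open>f i\<close> vanishing on \<open>C i\<close> but
  not on \<open>C (i + 1)\<close>. The \<open>N ^ d\<close> monomials in the \<open>f i\<close> with exponents below \<open>N\<close> are linearly
  independent on \<open>C d\<close> and lie in a space of dimension \<open>O(N ^ n)\<close>, whence \<open>d \<le> n\<close>.\<close>

section \<open>Evaluation of polynomials\<close>

text \<open>The inner product of \<open>mpeval\<close>, split off because multiplicativity of
  evaluation comes down to exponents adding up on monomials.\<close>

definition monom_eval :: "('x \<Rightarrow>\<^sub>0 nat) \<Rightarrow> ('x \<Rightarrow> 'k::comm_semiring_1) \<Rightarrow> 'k" where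
  "monom_eval m a = (\<Prod>v\<in>Poly_Mapping.keys m. a v ^ Poly_Mapping.lookup m v)"

lemma monom_eval_superset:
  assumes "finite K" "Poly_Mapping.keys m \<subseteq> K"
  shows "monom_eval m a = (\<Prod>v\<in>K. a v ^ Poly_Mapping.lookup m v)"
  unfolding monom_eval_def
  by (rule prod.mono_neutral_left) (use assms in \<open>auto simp: in_keys_iff\<close>)

lemma monom_eval_zero [simp]: "monom_eval 0 a = 1"
  by (simp add: monom_eval_def)

lemma monom_eval_add: "monom_eval (m + n) a = monom_eval m a * monom_eval n a"
proof -
  let ?K = "Poly_Mapping.keys m \<union> Poly_Mapping.keys n"
  have "monom_eval (m + n) a = (\<Prod>v\<in>?K. a v ^ Poly_Mapping.lookup (m + n) v)"
    by (rule monom_eval_superset) (use keys_add[of m n] in auto)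
  also have "\<dots> = (\<Prod>v\<in>?K. a v ^ Poly_Mapping.lookup m v) * (\<Prod>v\<in>?K. a v ^ Poly_Mapping.lookup n v)"
    by (simp add: lookup_add power_add prod.distrib)
  also have "\<dots> = monom_eval m a * monom_eval n a"
    by (simp add: monom_eval_superset[of ?K])
  finally show ?thesis .
qed

lemma monom_eval_single [simp]: "monom_eval (Poly_Mapping.single v n) a = a v ^ n"
  by (subst monom_eval_superset[of "{v}"]) auto

lemma mpeval_monom_eval:
  "mpeval f a = (\<Sum>m\<in>Poly_Mapping.keys f. Poly_Mapping.lookup f m * monom_eval m a)"
  by (simp add: mpeval_def monom_eval_def)

lemma mpeval_superset:
  assumes "finite K" "Poly_Mapping.keys f \<subseteq> K"
  shows "mpeval f a = (\<Sum>m\<in>K. Poly_Mapping.lookup f m * monom_eval m a)"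
  unfolding mpeval_monom_eval
  by (rule sum.mono_neutral_left) (use assms in \<open>auto simp: in_keys_iff\<close>)

lemma mpeval_zero [simp]: "mpeval 0 a = 0"
  by (simp add: mpeval_def)

lemma mpeval_single [simp]: "mpeval (Poly_Mapping.single m c) a = c * monom_eval m a"
  by (subst mpeval_superset[of "{m}"]) auto

lemma mpeval_one [simp]: "mpeval 1 a = 1"
  unfolding single_one[symmetric] by (simp del: single_one)

lemma mpeval_add [simp]: "mpeval (f + g) a = mpeval f a + mpeval g a"
proof -
  let ?K = "Poly_Mapping.keys f \<union> Poly_Mapping.keys g"
  have "mpeval (f + g) a = (\<Sum>m\<in>?K. Poly_Mapping.lookup (f + g) m * monom_eval m a)"
    by (rule mpeval_superset) (use keys_add[of f g] in auto)
  also have "\<dots> = mpeval f a + mpeval g a"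
    by (simp add: lookup_add distrib_right sum.distrib mpeval_superset[of ?K])
  finally show ?thesis .
qed

lemma mpeval_sum [simp]: "mpeval (\<Sum>i\<in>I. f i) a = (\<Sum>i\<in>I. mpeval (f i) a)"
  by (induction I rule: infinite_finite_induct) auto

lemma poly_mapping_sum_singles:
  "f = (\<Sum>m\<in>Poly_Mapping.keys f. Poly_Mapping.single m (Poly_Mapping.lookup f m))"
proof (rule poly_mapping_eqI)
  fix n
  have "Poly_Mapping.lookup (\<Sum>m\<in>Poly_Mapping.keys f. Poly_Mapping.single m (Poly_Mapping.lookup f m)) n
      = (\<Sum>m\<in>Poly_Mapping.keys f. if m = n then Poly_Mapping.lookup f n else 0)"
    unfolding lookup_sum by (rule sum.cong) (auto simp: lookup_single when_def)
  also have "\<dots> = Poly_Mapping.lookup f n"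
    by (simp add: in_keys_iff)
  finally show "Poly_Mapping.lookup f n = Poly_Mapping.lookup
    (\<Sum>m\<in>Poly_Mapping.keys f. Poly_Mapping.single m (Poly_Mapping.lookup f m)) n" by simp
qed

lemma mpeval_mult [simp]: "mpeval (f * g) a = mpeval f a * mpeval g a"
proof -
  have "mpeval (f * g) a
      = mpeval ((\<Sum>m\<in>Poly_Mapping.keys f. Poly_Mapping.single m (Poly_Mapping.lookup f m)) *
          (\<Sum>n\<in>Poly_Mapping.keys g. Poly_Mapping.single n (Poly_Mapping.lookup g n))) a"
    by (simp flip: poly_mapping_sum_singles)
  also have "\<dots> = (\<Sum>m\<in>Poly_Mapping.keys f. \<Sum>n\<in>Poly_Mapping.keys g.
      (Poly_Mapping.lookup f m * monom_eval m a) * (Poly_Mapping.lookup g n * monom_eval n a))"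
    by (simp add: sum_product mult_single monom_eval_add mult_ac)
  also have "\<dots> = mpeval f a * mpeval g a"
    by (simp add: sum_product mpeval_monom_eval)
  finally show ?thesis .
qed

lemma mpeval_power [simp]: "mpeval (f ^ n) a = mpeval f a ^ n"
  by (induction n) auto

lemma pderiv_sum:
  "pderiv (\<Sum>i\<in>I. p i) = (\<Sum>i\<in>I. pderiv (p i :: 'k::{comm_semiring_1,semiring_no_zero_divisors} poly))"
  by (induction I rule: infinite_finite_induct) (auto simp: pderiv_add)

text \<open>Substituting the linear polynomials \<open>[:a v, w v:]\<close> gives a univariate
  polynomial whose formal derivative at 0 is the directional derivative, in any characteristic.
  Questions about \<open>f\<close> thereby become questions about roots of \<open>p\<close>.\<close>

lemma mpeval_on_line:
  fixes f :: "('x, 'k::{comm_ring_1,semiring_no_zero_divisors}) mpoly"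
  obtains p where "\<And>t. poly p t = mpeval f (\<lambda>v. a v + t * w v)" "poly (pderiv p) 0 = mpdiff f a w"
proof
  let ?p = "\<Sum>m\<in>Poly_Mapping.keys f. [:Poly_Mapping.lookup f m:] *
      (\<Prod>v\<in>Poly_Mapping.keys m. [:a v, w v:] ^ Poly_Mapping.lookup m v)"
  show "poly ?p t = mpeval f (\<lambda>v. a v + t * w v)" for t
    by (simp add: poly_sum poly_prod mpeval_def)
  have "poly (pderiv (\<Prod>v\<in>Poly_Mapping.keys m. [:a v, w v:] ^ Poly_Mapping.lookup m v)) 0
    = (\<Sum>u\<in>Poly_Mapping.keys m. of_nat (Poly_Mapping.lookup m u) * a u ^ (Poly_Mapping.lookup m u - 1) * w u *
                   (\<Prod>v\<in>Poly_Mapping.keys m - {u}. a v ^ Poly_Mapping.lookup m v))" for m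
    by (simp add: pderiv_prod pderiv_power pderiv_pCons poly_sum poly_prod mult_ac)
  then show "poly (pderiv ?p) 0 = mpdiff f a w"
    by (simp add: pderiv_sum poly_sum pderiv_smult mpdiff_def)
qed

text \<open>Over a finite field, adding 1 to the product of all linear factors would give a
  nonconstant polynomial without roots.\<close>

lemma infinite_UNIV_alg_closed: "infinite (UNIV :: 'k::alg_closed_field set)"
proof
  assume fin: "finite (UNIV :: 'k set)"
  let ?q = "\<Prod>x\<in>(UNIV :: 'k set). [:-x, 1:]"
  have "degree ?q = card (UNIV :: 'k set)"
    by (subst degree_prod_eq_sum_degree) auto
  moreover have "card (UNIV :: 'k set) > 0"
    using fin by (simp add: card_gt_0_iff)
  ultimately have "degree (1 + ?q) > 0"
    by (subst degree_add_eq_right) auto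
  then obtain x where "poly (1 + ?q) x = 0"
    using alg_closed_imp_poly_has_root by blast
  moreover have "poly ?q x = 0"
    using fin by (auto simp: poly_prod prod_zero_iff)
  ultimately show False
    by simp
qed

text \<open>A univariate polynomial with infinitely many roots is zero, and so is its derivative.
  The first conclusion serves Zariski closures, the second tangent spaces.\<close>

lemma mpeval_zero_on_line:
  fixes f :: "('x, 'k::field) mpoly"
  assumes "infinite {t. mpeval f (\<lambda>v. a v + t * w v) = 0}"
  shows "mpeval f a = 0" "mpdiff f a w = 0"
proof -
  obtain p where p: "\<And>t. poly p t = mpeval f (\<lambda>v. a v + t * w v)"
      "poly (pderiv p) 0 = mpdiff f a w"
    using mpeval_on_line[of f a w] by metis
  have "infinite {t. poly p t = 0}"
    using assms p(1) by simp
  then have "p = 0"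
    using poly_roots_finite by blast
  then show "mpeval f a = 0" "mpdiff f a w = 0"
    using p(1)[of 0] p(2) by auto
qed

section \<open>Closed sets\<close>

lemma zclosed_Un:
  fixes Y1 Y2 :: "('x \<Rightarrow> 'k::field) set"
  assumes "zclosed Y1" "zclosed Y2"
  shows "zclosed (Y1 \<union> Y2)"
proof -
  obtain F G where FG: "Y1 = zset F" "Y2 = zset G"
    using assms by (auto simp: zclosed_def)
  have "Y1 \<union> Y2 = zset {f * g | f g. f \<in> F \<and> g \<in> G}"
    unfolding FG zset_def by (auto 4 4)
  then show ?thesis
    unfolding zclosed_def by blast
qed

lemma zclosed_UN:
  fixes Y :: "'i \<Rightarrow> ('x \<Rightarrow> 'k::field) set"
  assumes "finite I" "\<And>i. i \<in> I \<Longrightarrow> zclosed (Y i)"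
  shows "zclosed (\<Union>i\<in>I. Y i)"
  using assms
proof (induction I rule: finite_induct)
  case empty
  have "(\<Union>i\<in>{}. Y i) = zset {1}"
    by (auto simp: zset_def)
  then show ?case
    unfolding zclosed_def by blast
qed (auto intro: zclosed_Un)

lemma zclosed_coords: "zclosed {a :: 'x \<Rightarrow> 'k::field. \<forall>v\<in>V. a v = 0}"
proof -
  have "{a :: 'x \<Rightarrow> 'k. \<forall>v\<in>V. a v = 0}
      = zset ((\<lambda>v. Poly_Mapping.single (Poly_Mapping.single v 1) 1) ` V)"
    by (auto simp: zset_def)
  then show ?thesis
    unfolding zclosed_def by blast
qed

lemma zclosure_minimal: "zclosed Y \<Longrightarrow> S \<subseteq> Y \<Longrightarrow> zclosure S \<subseteq> Y"
  unfolding zclosed_def zclosure_def zset_def vanish_def by blast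

lemma zclosed_zset: "zclosed (zset F)"
  unfolding zclosed_def by blast

lemma zclosed_not_subset_vanish:
  assumes "zclosed Y" "\<not> Z \<subseteq> Y"
  obtains f where "f \<in> vanish Y" "f \<notin> vanish Z"
  using assms unfolding zclosed_def zset_def vanish_def by blast

text \<open>Irreducibility is stated for two closed sets; induction extends it to finitely many. The
  empty union is excluded because \<open>Y\<close> is nonempty.\<close>

lemma zirreducible_subset_UN:
  fixes C :: "'i \<Rightarrow> ('x \<Rightarrow> 'k::field) set"
  assumes "zirreducible Y" "finite I" "\<And>i. i \<in> I \<Longrightarrow> zclosed (C i)" "Y \<subseteq> (\<Union>i\<in>I. C i)"
  shows "\<exists>i\<in>I. Y \<subseteq> C i"
  using assms(2-)
proof (induction I rule: finite_induct)
  case empty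
  then show ?case
    using assms(1) by (auto simp: zirreducible_def)
next
  case (insert i I)
  have "zclosed (C i)" "zclosed (\<Union>i\<in>I. C i)" "Y \<subseteq> C i \<union> (\<Union>i\<in>I. C i)"
    using insert by (auto intro: zclosed_UN)
  then have "Y \<subseteq> C i \<or> Y \<subseteq> (\<Union>i\<in>I. C i)"
    using assms(1) unfolding zirreducible_def by blast
  then show ?case
    using insert by auto
qed

text \<open>The vanishing ideal of an irreducible set is prime; this is what permits cancelling a
  factor \<open>f\<close>.\<close>

lemma zirreducible_mult_vanish:
  fixes Y :: "('x \<Rightarrow> 'k::field) set"
  assumes "zirreducible Y" "f * g \<in> vanish Y" "f \<notin> vanish Y"
  shows "g \<in> vanish Y"
proof -
  have "Y \<subseteq> zset {f} \<union> zset {g}"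
    using assms(2) by (auto simp: vanish_def zset_def)
  then have "Y \<subseteq> zset {f} \<or> Y \<subseteq> zset {g}"
    using assms(1) zclosed_zset unfolding zirreducible_def by blast
  then show ?thesis
    using assms(3) by (auto simp: vanish_def zset_def)
qed

section \<open>Dimension of coordinate subspaces\<close>

definition coord_subspace :: "'x set \<Rightarrow> ('x \<Rightarrow> 'k::zero) set" where
  "coord_subspace A = {a. \<forall>v. v \<notin> A \<longrightarrow> a v = 0}"

lemma coord_subspace_subset_iff:
  "coord_subspace A \<subseteq> (coord_subspace B :: ('x \<Rightarrow> 'k::zero_neq_one) set) \<longleftrightarrow> A \<subseteq> B"
proof
  assume sub: "coord_subspace A \<subseteq> (coord_subspace B :: ('x \<Rightarrow> 'k) set)"
  show "A \<subseteq> B"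
  proof
    fix v assume "v \<in> A"
    then have "(\<lambda>x. if x = v then 1 else 0) \<in> (coord_subspace A :: ('x \<Rightarrow> 'k) set)"
      by (auto simp: coord_subspace_def)
    then have "(\<lambda>x. if x = v then 1 else 0) \<in> (coord_subspace B :: ('x \<Rightarrow> 'k) set)"
      using sub by blast
    then show "v \<in> B"
      by (auto simp: coord_subspace_def split: if_splits)
  qed
qed (auto simp: coord_subspace_def)

lemma zclosed_coord_subspace: "zclosed (coord_subspace A :: ('x \<Rightarrow> 'k::field) set)"
  using zclosed_coords[of "- A"] by (simp add: coord_subspace_def Ball_def)

text \<open>Two polynomials that do not vanish at \<open>a\<close> and \<open>b\<close> respectively are both nonzero at a
  generic point of the line through \<open>a\<close> and \<open>b\<close>.\<close>

lemma zirreducible_coord_subspace: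
  "zirreducible (coord_subspace A :: ('x \<Rightarrow> 'k::alg_closed_field) set)"
  unfolding zirreducible_def
proof (intro conjI allI impI)
  let ?L = "coord_subspace A :: ('x \<Rightarrow> 'k) set"
  show "zclosed ?L"
    by (rule zclosed_coord_subspace)
  have "(\<lambda>_. 0) \<in> ?L"
    by (simp add: coord_subspace_def)
  then show "?L \<noteq> {}"
    by blast
  fix Y1 Y2 :: "('x \<Rightarrow> 'k) set"
  assume Y: "zclosed Y1 \<and> zclosed Y2 \<and> ?L \<subseteq> Y1 \<union> Y2"
  show "?L \<subseteq> Y1 \<or> ?L \<subseteq> Y2"
  proof (rule ccontr)
    assume "\<not> ?thesis"
    then obtain f g where f: "f \<in> vanish Y1" "f \<notin> vanish ?L" and g: "g \<in> vanish Y2" "g \<notin> vanish ?L"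
      using Y by (metis zclosed_not_subset_vanish)
    then obtain a b where ab: "a \<in> ?L" "b \<in> ?L" "mpeval f a \<noteq> 0" "mpeval g b \<noteq> 0"
      unfolding vanish_def by blast
    have fg: "mpeval f x * mpeval g x = 0" if "x \<in> ?L" for x
    proof -
      have "x \<in> Y1 \<or> x \<in> Y2"
        using Y that by blast
      then show ?thesis
        using f(1) g(1) by (auto simp: vanish_def)
    qed
    let ?w = "\<lambda>v. b v - a v"
    obtain p where p: "\<And>t. poly p t = mpeval f (\<lambda>v. a v + t * ?w v)"
      by (rule mpeval_on_line[of f a ?w]) (rule that)
    obtain q where q: "\<And>t. poly q t = mpeval g (\<lambda>v. a v + t * ?w v)"
      by (rule mpeval_on_line[of g a ?w]) (rule that)
    have "(\<lambda>v. a v + t * ?w v) \<in> ?L" for t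
      using ab by (auto simp: coord_subspace_def)
    then have "poly (p * q) t = 0" for t
      using fg p q by simp
    then have "{t. poly (p * q) t = 0} = UNIV"
      by blast
    then have "p * q = 0"
      using poly_roots_finite[of "p * q"] infinite_UNIV_alg_closed[where 'k = 'k] by metis
    then have "p = 0 \<or> q = 0"
      by simp
    \<comment> \<open>The line passes through \<open>a\<close> at \<open>t = 0\<close>, where
      \<open>p\<close> is nonzero, and through \<open>b\<close> at \<open>t = 1\<close>, where
      \<open>q\<close> is nonzero.\<close>
    then show False
      using p[of 0] q[of 1] ab by auto
  qed
qed

section \<open>Linear algebra for the counting argument\<close>

lemma nontrivial_linear_relation:
  fixes m :: "'i \<Rightarrow> 'j \<Rightarrow> 'k::field"
  assumes "finite J" "finite I" "card J < card I"
  shows "\<exists>c. (\<exists>i\<in>I. c i \<noteq> 0) \<and> (\<forall>j\<in>J. (\<Sum>i\<in>I. c i * m i j) = 0)"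
  using assms
proof (induction J arbitrary: I m rule: finite_induct)
  case empty
  then have "I \<noteq> {}"
    by auto
  then show ?case
    by (auto intro!: exI[of _ "\<lambda>_. 1"])
next
  case (insert j J)
  show ?case
  proof (cases "\<forall>i\<in>I. m i j = 0")
    case True
    have "card J < card I"
      using insert by simp
    then show ?thesis
      using insert.IH[of I m] insert.prems True by auto
  next
    case False
    then obtain k where k: "k \<in> I" "m k j \<noteq> 0"
      by blast
    let ?I = "I - {k}"
    \<comment> \<open>Gaussian elimination with pivot \<open>m k j\<close>: row \<open>k\<close>
      clears column \<open>j\<close> from the other rows, which leaves one equation and one unknown
      fewer.\<close>
    have "card J < card ?I"
      using insert.prems insert.hyps k by (simp add: less_diff_conv)
    then obtain c where c: "\<exists>i\<in>?I. c i \<noteq> 0"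
        "\<forall>l\<in>J. (\<Sum>i\<in>?I. c i * (m i l - m i j / m k j * m k l)) = 0"
      using insert.IH[of ?I "\<lambda>i l. m i l - m i j / m k j * m k l"] insert.prems(1)
      by auto
    \<comment> \<open>The pivot coefficient is the one that makes equation \<open>j\<close> hold;
      the other equations then reduce to those of the eliminated matrix.\<close>
    define d where "d = c(k := - (\<Sum>i\<in>?I. c i * m i j) / m k j)"
    have split: "(\<Sum>i\<in>I. d i * m i l)
        = - (\<Sum>i\<in>?I. c i * m i j) / m k j * m k l + (\<Sum>i\<in>?I. c i * m i l)" for l
    proof -
      have "(\<Sum>i\<in>I. d i * m i l) = d k * m k l + (\<Sum>i\<in>?I. d i * m i l)"
        using insert.prems k by (simp add: sum.remove)
      also have "(\<Sum>i\<in>?I. d i * m i l) = (\<Sum>i\<in>?I. c i * m i l)"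
        by (rule sum.cong) (auto simp: d_def)
      finally show ?thesis
        by (simp add: d_def)
    qed
    have "(\<Sum>i\<in>I. d i * m i j) = 0"
      using k by (simp add: split)
    moreover have "(\<Sum>i\<in>I. d i * m i l) = 0" if "l \<in> J" for l
    proof -
      have "(\<Sum>i\<in>?I. c i * (m i l - m i j / m k j * m k l))
          = (\<Sum>i\<in>?I. c i * m i l) - (\<Sum>i\<in>?I. c i * m i j) / m k j * m k l"
        by (simp add: algebra_simps sum_subtractf sum_divide_distrib sum_distrib_left sum_distrib_right)
      then show ?thesis
        using c(2) that by (simp add: split)
    qed
    moreover have "\<exists>i\<in>I. d i \<noteq> 0"
      using c(1) by (auto simp: d_def)
    ultimately show ?thesis
      by blast
  qed
qed

text \<open>Independence of an indexed family, so that repetitions count as dependence and the size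
  of the index set can be compared with a dimension.\<close>

definition indep_on :: "'a set \<Rightarrow> 'i set \<Rightarrow> ('i \<Rightarrow> 'a \<Rightarrow> 'k::comm_semiring_1) \<Rightarrow> bool" where
  "indep_on Y I g \<longleftrightarrow> (\<forall>c. (\<forall>a\<in>Y. (\<Sum>i\<in>I. c i * g i a) = 0) \<longrightarrow> (\<forall>i\<in>I. c i = 0))"

text \<open>Restricting a relation to \<open>Y\<close> kills all positive powers of \<open>f\<close>; since \<open>f\<close> is a non-zero-divisor
  on \<open>Y'\<close>, the remaining relation can be divided by \<open>f\<close>.\<close>

lemma indep_on_times_powers:
  fixes g :: "'i \<Rightarrow> ('x, 'k::field) mpoly"
  assumes ind: "indep_on Y I (\<lambda>i. mpeval (g i))" and fin: "finite I"
    and irr: "zirreducible Y'" and sub: "Y \<subseteq> Y'"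
    and f: "f \<in> vanish Y" "f \<notin> vanish Y'"
  shows "indep_on Y' (I \<times> {..<N}) (\<lambda>(i, j). mpeval (g i * f ^ j))"
  unfolding indep_on_def
proof (intro allI impI)
  fix c :: "'i \<times> nat \<Rightarrow> 'k"
  assume "\<forall>a\<in>Y'. (\<Sum>x\<in>I \<times> {..<N}. c x * (case x of (i, j) \<Rightarrow> mpeval (g i * f ^ j)) a) = 0"
  then have "\<forall>a\<in>Y'. (\<Sum>i\<in>I. \<Sum>j<N. c (i, j) * (mpeval (g i) a * mpeval f a ^ j)) = 0"
    by (simp add: sum.cartesian_product case_prod_unfold)
  then have "\<forall>i\<in>I. \<forall>j<N. c (i, j) = 0"
  proof (induction N arbitrary: c)
    case (Suc N)
    \<comment> \<open>The terms with positive exponent, with one factor \<open>f\<close> taken out.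
      Peeling off exponent 0 rather than the top one is what makes this division possible.\<close>
    let ?h = "\<Sum>i\<in>I. \<Sum>j<N. Poly_Mapping.single 0 (c (i, Suc j)) * (g i * f ^ j)"
    have split: "(\<Sum>i\<in>I. \<Sum>j<Suc N. c (i, j) * (mpeval (g i) a * mpeval f a ^ j))
        = (\<Sum>i\<in>I. c (i, 0) * mpeval (g i) a) + mpeval (f * ?h) a" for a
      unfolding sum.lessThan_Suc_shift by (simp add: sum.distrib sum_distrib_left mult_ac)
    have "(\<Sum>i\<in>I. c (i, 0) * mpeval (g i) a) = 0" if "a \<in> Y" for a
    proof -
      have a: "mpeval f a = 0" "a \<in> Y'"
        using that f(1) sub by (auto simp: vanish_def)
      then show ?thesis
        using bspec[OF Suc.prems a(2)] unfolding split by simp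
    qed
    then have c0: "\<forall>i\<in>I. c (i, 0) = 0"
      using ind[unfolded indep_on_def, rule_format, of "\<lambda>i. c (i, 0)"] by blast
    then have "f * ?h \<in> vanish Y'"
      using Suc.prems unfolding split by (simp add: vanish_def del: mpeval_mult mpeval_sum)
    then have "?h \<in> vanish Y'"
      using zirreducible_mult_vanish irr f(2) by blast
    then have "\<forall>i\<in>I. \<forall>j<N. c (i, Suc j) = 0"
      using Suc.IH[of "\<lambda>(i, j). c (i, Suc j)"] by (simp add: vanish_def)
    with c0 show ?case
      by (auto simp: less_Suc_eq_0_disj)
  qed simp
  then show "\<forall>x\<in>I \<times> {..<N}. c x = 0"
    by auto
qed

text \<open>Bounding each exponent separately, and not the total degree, makes the number of
  available monomials exactly \<open>(M + 1) ^ card A\<close>. Only values on the subspace matter,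
  so variables outside \<open>A\<close> disappear.\<close>

definition box_poly :: "'x set \<Rightarrow> nat \<Rightarrow> (('x \<Rightarrow> 'k::comm_semiring_1) \<Rightarrow> 'k) \<Rightarrow> bool" where
  "box_poly A M g \<longleftrightarrow> (\<exists>c. \<forall>a\<in>coord_subspace A.
     g a = (\<Sum>m\<in>A \<rightarrow>\<^sub>E {..M}. c m * (\<Prod>v\<in>A. a v ^ m v)))"

lemma box_poly_monom:
  fixes A :: "'x set"
  assumes "finite A" "\<And>v. v \<in> A \<Longrightarrow> m v \<le> M"
  shows "box_poly A M (\<lambda>a::'x \<Rightarrow> 'k::comm_semiring_1. \<Prod>v\<in>A. a v ^ m v)"
  unfolding box_poly_def
proof (intro exI ballI)
  fix a :: "'x \<Rightarrow> 'k"
  let ?r = "restrict m A"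
  have fin: "finite (A \<rightarrow>\<^sub>E {..M})"
    using assms by (simp add: finite_PiE)
  have r: "?r \<in> A \<rightarrow>\<^sub>E {..M}"
    using assms by auto
  have "(\<Sum>m'\<in>A \<rightarrow>\<^sub>E {..M}. (if m' = ?r then 1 else 0) * (\<Prod>v\<in>A. a v ^ m' v))
     = (\<Sum>m'\<in>A \<rightarrow>\<^sub>E {..M}. if m' = ?r then (\<Prod>v\<in>A. a v ^ ?r v) else 0)"
    by (rule sum.cong) auto
  also have "\<dots> = (\<Prod>v\<in>A. a v ^ ?r v)"
    using fin r by simp
  also have "\<dots> = (\<Prod>v\<in>A. a v ^ m v)"
    by (rule prod.cong) auto
  finally show "(\<Prod>v\<in>A. a v ^ m v)
      = (\<Sum>m'\<in>A \<rightarrow>\<^sub>E {..M}. (if m' = ?r then 1 else 0) * (\<Prod>v\<in>A. a v ^ m' v))" by simp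
qed

lemma box_poly_zero: "box_poly A M (\<lambda>a. 0)"
  unfolding box_poly_def by (rule exI[of _ "\<lambda>_. 0"]) simp

lemma box_poly_add: "box_poly A M g \<Longrightarrow> box_poly A M h \<Longrightarrow> box_poly A M (\<lambda>a. g a + h a)"
  unfolding box_poly_def
proof (elim exE)
  fix c d
  assume "\<forall>a\<in>coord_subspace A. g a = (\<Sum>m\<in>A \<rightarrow>\<^sub>E {..M}. c m * (\<Prod>v\<in>A. a v ^ m v))"
    "\<forall>a\<in>coord_subspace A. h a = (\<Sum>m\<in>A \<rightarrow>\<^sub>E {..M}. d m * (\<Prod>v\<in>A. a v ^ m v))"
  then show "\<exists>c. \<forall>a\<in>coord_subspace A. g a + h a = (\<Sum>m\<in>A \<rightarrow>\<^sub>E {..M}. c m * (\<Prod>v\<in>A. a v ^ m v))"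
    by (intro exI[of _ "\<lambda>m. c m + d m"]) (simp add: distrib_right sum.distrib)
qed

lemma box_poly_scale: "box_poly A M g \<Longrightarrow> box_poly A M (\<lambda>a. k * g a)"
  unfolding box_poly_def
proof (elim exE)
  fix c
  assume "\<forall>a\<in>coord_subspace A. g a = (\<Sum>m\<in>A \<rightarrow>\<^sub>E {..M}. c m * (\<Prod>v\<in>A. a v ^ m v))"
  then show "\<exists>c. \<forall>a\<in>coord_subspace A. k * g a = (\<Sum>m\<in>A \<rightarrow>\<^sub>E {..M}. c m * (\<Prod>v\<in>A. a v ^ m v))"
    by (intro exI[of _ "\<lambda>m. k * c m"]) (simp add: sum_distrib_left mult.assoc)
qed

lemma box_poly_sum:
  "(\<And>i. i \<in> I \<Longrightarrow> box_poly A M (g i)) \<Longrightarrow> box_poly A M (\<lambda>a. \<Sum>i\<in>I. g i a)"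
  by (induction I rule: infinite_finite_induct) (simp_all add: box_poly_zero box_poly_add)

lemma box_poly_cong:
  "(\<And>a. a \<in> coord_subspace A \<Longrightarrow> g a = h a) \<Longrightarrow> box_poly A M g \<longleftrightarrow> box_poly A M h"
  by (simp add: box_poly_def)

lemma box_poly_mult:
  assumes "finite A" "box_poly A M g" "box_poly A M' h"
  shows "box_poly A (M + M') (\<lambda>a. g a * h a)"
proof -
  obtain c d where
    c: "\<And>a. a\<in>coord_subspace A \<Longrightarrow> g a = (\<Sum>m\<in>A \<rightarrow>\<^sub>E {..M}. c m * (\<Prod>v\<in>A. a v ^ m v))" and
    d: "\<And>a. a\<in>coord_subspace A \<Longrightarrow> h a = (\<Sum>m\<in>A \<rightarrow>\<^sub>E {..M'}. d m * (\<Prod>v\<in>A. a v ^ m v))"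
    using assms(2,3) unfolding box_poly_def by blast
  let ?e = "\<lambda>a. \<Sum>m\<in>A \<rightarrow>\<^sub>E {..M}. \<Sum>n\<in>A \<rightarrow>\<^sub>E {..M'}. (c m * d n) * (\<Prod>v\<in>A. a v ^ (m v + n v))"
  have "g a * h a = ?e a" if "a \<in> coord_subspace A" for a
    by (simp add: c[OF that] d[OF that] sum_product power_add prod.distrib mult_ac)
  moreover have "box_poly A (M + M') ?e"
    by (intro box_poly_sum box_poly_scale box_poly_monom)
      (use assms(1) in \<open>auto intro!: add_mono dest: PiE_mem\<close>)
  ultimately show ?thesis
    using box_poly_cong[of A "\<lambda>a. g a * h a" ?e] by blast
qed

lemma box_poly_one:
  assumes "finite A"
  shows "box_poly A M (\<lambda>a. 1)"
  using box_poly_monom[OF assms, of "\<lambda>_. 0" M] by simp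

lemma box_poly_mono:
  assumes "finite A" "box_poly A M g" "M \<le> M'"
  shows "box_poly A M' g"
  using box_poly_mult[OF assms(1,2) box_poly_one[OF assms(1), of "M' - M"]] assms(3) by simp

lemma box_poly_power:
  assumes "finite A" "box_poly A M g"
  shows "box_poly A (n * M) (\<lambda>a. g a ^ n)"
proof (induction n)
  case 0
  then show ?case
    by (simp add: box_poly_one assms)
next
  case (Suc n)
  then show ?case
    using box_poly_mult[OF assms(1,2) Suc] by simp
qed

lemma box_poly_mpeval:
  fixes f :: "('x, 'k::comm_semiring_1) mpoly"
  assumes "finite A"
  obtains M where "box_poly A M (mpeval f)"
proof -
  let ?K = "\<Union>m\<in>Poly_Mapping.keys f. Poly_Mapping.lookup m ` A"
  \<comment> \<open>The extra 0 keeps the maximum defined when \<open>f = 0\<close> or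
    \<open>A\<close> is empty.\<close>
  define M where "M = Max (insert 0 ?K)"
  have M: "Poly_Mapping.lookup m v \<le> M" if "m \<in> Poly_Mapping.keys f" "v \<in> A" for m v
    unfolding M_def by (rule Max_ge) (use that assms in auto)
  have "box_poly A M (monom_eval m :: ('x \<Rightarrow> 'k) \<Rightarrow> 'k)" if m: "m \<in> Poly_Mapping.keys f" for m
  proof (cases "Poly_Mapping.keys m \<subseteq> A")
    case True
    then have "monom_eval m = (\<lambda>a::'x \<Rightarrow> 'k. \<Prod>v\<in>A. a v ^ Poly_Mapping.lookup m v)"
      by (auto simp: monom_eval_superset[OF assms])
    then show ?thesis
      using box_poly_monom[OF assms M[OF m]] by simp
  next
    case False
    then obtain v where v: "v \<in> Poly_Mapping.keys m" "v \<notin> A"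
      by blast
    \<comment> \<open>A monomial containing a variable outside \<open>A\<close> vanishes on the
      whole subspace.\<close>
    have "monom_eval m a = 0" if "a \<in> coord_subspace A" for a :: "'x \<Rightarrow> 'k"
      unfolding monom_eval_def
      by (rule prod_zero)
        (use v that in \<open>auto intro!: bexI[of _ v] simp: coord_subspace_def in_keys_iff zero_power\<close>)
    then show ?thesis
      using box_poly_cong[of A "monom_eval m" "\<lambda>_. 0"] box_poly_zero by blast
  qed
  then have "box_poly A M (\<lambda>a. \<Sum>m\<in>Poly_Mapping.keys f. Poly_Mapping.lookup f m * monom_eval m a)"
    by (intro box_poly_sum box_poly_scale)
  then show thesis
    using that[of M] by (simp add: mpeval_monom_eval[abs_def])
qed

text \<open>Each step of the chain multiplies the family by the powers \<open>f d ^ j\<close> with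
  \<open>j < N\<close>. Its size grows by the factor \<open>N\<close>, its exponent bound by at most
  \<open>N * D\<close>.\<close>

lemma zirreducible_chain_independent:
  fixes C :: "nat \<Rightarrow> ('x \<Rightarrow> 'k::field) set"
  assumes "finite A"
    and irr: "\<And>i. i \<le> d \<Longrightarrow> zirreducible (C i)"
    and sub: "\<And>i. i < d \<Longrightarrow> C i \<subseteq> C (Suc i)"
    and f: "\<And>i. i < d \<Longrightarrow> f i \<in> vanish (C i)" "\<And>i. i < d \<Longrightarrow> f i \<notin> vanish (C (Suc i))"
    and box: "\<And>i. i < d \<Longrightarrow> box_poly A D (mpeval (f i))"
  shows "\<exists>(I :: nat set) g. finite I \<and> card I = N ^ d \<and> indep_on (C d) I (\<lambda>i. mpeval (g i))
           \<and> (\<forall>i\<in>I. box_poly A (d * N * D) (mpeval (g i)))"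
  using irr sub f box
proof (induction d)
  case 0
  then obtain a where "a \<in> C 0"
    by (auto simp: zirreducible_def)
  \<comment> \<open>The constant 1 is independent because \<open>C 0\<close> has a point.\<close>
  then have "indep_on (C 0) {0::nat} (\<lambda>i a. 1 :: 'k)"
    by (auto simp: indep_on_def)
  moreover have "box_poly A 0 (\<lambda>a :: 'x \<Rightarrow> 'k. 1)"
    by (rule box_poly_one[OF assms(1)])
  ultimately show ?case
    by (intro exI[of _ "{0}"] exI[of _ "\<lambda>_. 1"]) simp
next
  case (Suc d)
  have "\<exists>(I :: nat set) g. finite I \<and> card I = N ^ d \<and> indep_on (C d) I (\<lambda>i. mpeval (g i))
           \<and> (\<forall>i\<in>I. box_poly A (d * N * D) (mpeval (g i)))"
    by (rule Suc.IH) (use Suc.prems in auto)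
  then obtain I :: "nat set" and g where I: "finite I" "card I = N ^ d"
      "indep_on (C d) I (\<lambda>i. mpeval (g i))"
      "\<And>i. i \<in> I \<Longrightarrow> box_poly A (d * N * D) (mpeval (g i))"
    by blast
  define h where "h = (\<lambda>(i, j). g i * f d ^ j)"
  have ind: "indep_on (C (Suc d)) (I \<times> {..<N}) (\<lambda>x. mpeval (h x))"
    using indep_on_times_powers[OF I(3,1), of "C (Suc d)" "f d" N] Suc.prems
    by (simp add: h_def case_prod_unfold)
  have bx: "box_poly A (Suc d * N * D) (mpeval (h x))" if xI: "x \<in> I \<times> {..<N}" for x
  proof -
    obtain i j where x: "x = (i, j)" "i \<in> I" "j < N"
      using xI by auto
    have "box_poly A (d * N * D + j * D) (\<lambda>a. mpeval (g i) a * mpeval (f d) a ^ j)"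
      using box_poly_mult[OF assms(1) I(4) box_poly_power[OF assms(1)]] Suc.prems(5) x by blast
    moreover have "d * N * D + j * D \<le> Suc d * N * D"
      using x by (simp add: algebra_simps)
    ultimately have "box_poly A (Suc d * N * D) (\<lambda>a. mpeval (g i) a * mpeval (f d) a ^ j)"
      using box_poly_mono assms(1) by blast
    then show ?thesis
      by (simp add: x h_def box_poly_def)
  qed
  \<comment> \<open>Pairs are coded as naturals so that the index type stays the same throughout the
    induction.\<close>
  let ?I = "prod_encode ` (I \<times> {..<N})"
  have "card ?I = N ^ Suc d"
    by (simp add: card_image[OF inj_prod_encode] card_cartesian_product I(2))
  moreover have "indep_on (C (Suc d)) ?I (\<lambda>n. mpeval (h (prod_decode n)))"
    unfolding indep_on_def
  proof (intro allI impI)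
    fix c
    assume "\<forall>a\<in>C (Suc d). (\<Sum>n\<in>?I. c n * mpeval (h (prod_decode n)) a) = 0"
    then have "\<forall>a\<in>C (Suc d). (\<Sum>x\<in>I \<times> {..<N}. c (prod_encode x) * mpeval (h x) a) = 0"
      by (simp add: sum.reindex[OF inj_prod_encode])
    then have "\<forall>x\<in>I \<times> {..<N}. c (prod_encode x) = 0"
      using ind[unfolded indep_on_def, rule_format, of "\<lambda>x. c (prod_encode x)"] by blast
    then show "\<forall>n\<in>?I. c n = 0"
      by blast
  qed
  moreover have "finite ?I"
    using I(1) by simp
  moreover have "\<forall>n\<in>?I. box_poly A (Suc d * N * D) (mpeval (h (prod_decode n)))"
    using bx by auto
  ultimately show ?case
    by (intro exI[of _ ?I] exI[of _ "\<lambda>n. h (prod_decode n)"]) blast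
qed

lemma zirreducible_chain_length_le:
  fixes C :: "nat \<Rightarrow> ('x \<Rightarrow> 'k::field) set"
  assumes A: "finite A"
    and irr: "\<And>i. i \<le> n \<Longrightarrow> zirreducible (C i)"
    and le: "\<And>i. i \<le> n \<Longrightarrow> C i \<subseteq> coord_subspace A"
    and sub: "\<And>i. i < n \<Longrightarrow> C i \<subset> C (Suc i)"
  shows "n \<le> card A"
proof (rule ccontr)
  \<comment> \<open>A chain that is too long is cut down to \<open>card A + 1\<close>
    inclusions.\<close>
  define d where "d = Suc (card A)"
  assume "\<not> n \<le> card A"
  then have dn: "d \<le> n"
    by (simp add: d_def)
  have sub': "C i \<subseteq> C (Suc i)" if "i < d" for i
    using sub[of i] that dn by auto
  have "\<exists>f. f \<in> vanish (C i) \<and> f \<notin> vanish (C (Suc i))" if "i < d" for i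
    using zclosed_not_subset_vanish[of "C i" "C (Suc i)"] irr[of i] sub[of i] that dn
    by (auto simp: zirreducible_def)
  then obtain f where f: "\<And>i. i < d \<Longrightarrow> f i \<in> vanish (C i)"
      "\<And>i. i < d \<Longrightarrow> f i \<notin> vanish (C (Suc i))"
    by metis
  have "\<exists>M. box_poly A M (mpeval (f i))" for i
    using box_poly_mpeval[OF A] by metis
  then obtain M where M: "\<And>i. box_poly A (M i) (mpeval (f i))"
    by metis
  define D where "D = (\<Sum>i<d. M i)"
  have D: "box_poly A D (mpeval (f i))" if "i < d" for i
    by (rule box_poly_mono[OF A M]) (use that in \<open>auto simp: D_def intro: member_le_sum\<close>)
  \<comment> \<open>\<open>K\<close> is chosen so that \<open>d * N * D + 1 \<le> K * N\<close>, and
    \<open>N\<close> exceeds \<open>K ^ card A\<close>; hence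
    \<open>(K * N) ^ card A < N ^ (card A + 1)\<close>, so there are fewer monomials than
    independent functions.\<close>
  define K where "K = d * D + 1"
  define N where "N = K ^ card A + 1"
  have "\<exists>(I :: nat set) g. finite I \<and> card I = N ^ d \<and> indep_on (C d) I (\<lambda>i. mpeval (g i))
           \<and> (\<forall>i\<in>I. box_poly A (d * N * D) (mpeval (g i)))"
    by (rule zirreducible_chain_independent[where f = f])
      (use A irr sub' dn f D in auto)
  then obtain I :: "nat set" and g where I: "finite I" "card I = N ^ d"
      "indep_on (C d) I (\<lambda>i. mpeval (g i))"
      "\<And>i. i \<in> I \<Longrightarrow> box_poly A (d * N * D) (mpeval (g i))"
    by blast
  let ?J = "A \<rightarrow>\<^sub>E {..d * N * D}"
  have "card ?J = (d * N * D + 1) ^ card A"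
    using A by (simp add: card_PiE)
  also have "\<dots> \<le> (K * N) ^ card A"
    by (rule power_mono) (auto simp: K_def N_def algebra_simps)
  also have "\<dots> = K ^ card A * N ^ card A"
    by (simp add: power_mult_distrib)
  also have "\<dots> < N * N ^ card A"
    by (simp add: N_def)
  also have "\<dots> = card I"
    by (simp add: I d_def)
  finally have less: "card ?J < card I" .
  obtain c where c: "\<And>i a. i \<in> I \<Longrightarrow> a \<in> coord_subspace A \<Longrightarrow>
      mpeval (g i) a = (\<Sum>m\<in>?J. c i m * (\<Prod>v\<in>A. a v ^ m v))"
    using I(4) unfolding box_poly_def by metis
  have "finite ?J"
    using A by (simp add: finite_PiE)
  \<comment> \<open>The coefficient matrix has more rows than columns, so its rows are linearly
    dependent.\<close>
  then obtain e where e: "\<exists>i\<in>I. e i \<noteq> 0" "\<forall>m\<in>?J. (\<Sum>i\<in>I. e i * c i m) = 0"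
    using nontrivial_linear_relation[OF _ I(1) less, of c] by blast
  have "(\<Sum>i\<in>I. e i * mpeval (g i) a) = 0" if "a \<in> C d" for a
  proof -
    have a: "a \<in> coord_subspace A"
      using that le dn by blast
    have "(\<Sum>i\<in>I. e i * mpeval (g i) a) = (\<Sum>i\<in>I. \<Sum>m\<in>?J. e i * c i m * (\<Prod>v\<in>A. a v ^ m v))"
      by (simp add: c a sum_distrib_left mult.assoc)
    also have "\<dots> = (\<Sum>m\<in>?J. (\<Sum>i\<in>I. e i * c i m) * (\<Prod>v\<in>A. a v ^ m v))"
      by (subst sum.swap) (simp add: sum_distrib_right)
    also have "\<dots> = 0"
      using e(2) by simp
    finally show ?thesis .
  qed
  then show False
    using I(3) e(1) unfolding indep_on_def by blast
qed

lemma zdim_coord_subspace: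
  fixes A :: "'x set"
  assumes A: "finite A"
  shows "zdim (coord_subspace A :: ('x \<Rightarrow> 'k::alg_closed_field) set) = enat (card A)"
  unfolding zdim_def
proof (rule cSup_eq_maximum, goal_cases)
  case 1
  obtain h where h: "bij_betw h {0..<card A} A"
    using ex_bij_betw_nat_finite[OF A] by blast
  \<comment> \<open>Lower bound: the flag that frees the coordinates in \<open>A\<close> one at a
    time.\<close>
  let ?C = "\<lambda>i. coord_subspace (h ` {0..<i}) :: ('x \<Rightarrow> 'k) set"
  have "?C i \<subseteq> coord_subspace A" if "i \<le> card A" for i
    unfolding coord_subspace_subset_iff using h that by (auto simp: bij_betw_def)
  moreover have "?C i \<subset> ?C (Suc i)" if "i < card A" for i
  proof -
    have "h i \<notin> h ` {0..<i}"
      using h that inj_on_image_mem_iff[of h "{0..<card A}" i "{0..<i}"]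
      by (auto simp: bij_betw_def)
    moreover have "h i \<in> h ` {0..<Suc i}"
      by simp
    ultimately have "\<not> h ` {0..<Suc i} \<subseteq> h ` {0..<i}"
      by blast
    moreover have "h ` {0..<i} \<subseteq> h ` {0..<Suc i}"
      by auto
    ultimately show ?thesis
      by (simp only: less_le_not_le coord_subspace_subset_iff) simp
  qed
  ultimately have "(\<forall>i\<le>card A. zirreducible (?C i) \<and> ?C i \<subseteq> coord_subspace A)
      \<and> (\<forall>i<card A. ?C i \<subset> ?C (Suc i))"
    by (simp add: zirreducible_coord_subspace)
  then show ?case
    by (intro CollectI exI[of _ "card A"] conjI[OF refl] exI[of _ ?C])
next
  case (2 x)
  then obtain n and C :: "nat \<Rightarrow> ('x \<Rightarrow> 'k) set" where C: "x = enat n"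
      "\<And>i. i \<le> n \<Longrightarrow> zirreducible (C i)" "\<And>i. i \<le> n \<Longrightarrow> C i \<subseteq> coord_subspace A"
      "\<And>i. i < n \<Longrightarrow> C i \<subset> C (Suc i)"
    by auto
  then have "n \<le> card A"
    by (intro zirreducible_chain_length_le[OF A, of n C])
  then show ?case
    by (simp add: C(1))
qed

section \<open>Linear dimension\<close>

text \<open>The same lambda term as in \<open>smooth_points\<close>, so that \<open>fvs.dim\<close>
  is literally the dimension occurring there.\<close>

abbreviation fun_scale :: "'k::field \<Rightarrow> ('v \<Rightarrow> 'k) \<Rightarrow> 'v \<Rightarrow> 'k" where
  "fun_scale \<equiv> \<lambda>c w v. c * w v"

interpretation fvs: vector_space fun_scale
  by unfold_locales (auto simp: algebra_simps fun_eq_iff)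

definition unit_fun :: "'v \<Rightarrow> 'v \<Rightarrow> 'k::zero_neq_one" where
  "unit_fun u = (\<lambda>v. if v = u then 1 else 0)"

lemma inj_unit_fun: "inj (unit_fun :: 'v \<Rightarrow> 'v \<Rightarrow> 'k::zero_neq_one)"
  by (auto simp: inj_def unit_fun_def fun_eq_iff split: if_splits)

lemma sum_fun_apply: "(\<Sum>i\<in>I. f i) x = (\<Sum>i\<in>I. f i x :: 'k::comm_monoid_add)"
  by (induction I rule: infinite_finite_induct) auto

lemma independent_unit_fun:
  fixes A :: "'v::finite set"
  shows "fvs.independent (unit_fun ` A :: ('v \<Rightarrow> 'k::field) set)"
proof (rule fvs.independent_if_scalars_zero)
  fix c :: "('v \<Rightarrow> 'k) \<Rightarrow> 'k" and b :: "'v \<Rightarrow> 'k"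
  assume "(\<Sum>w\<in>unit_fun ` A. fun_scale (c w) w) = 0" and "b \<in> unit_fun ` A"
  then obtain u where u: "u \<in> A" "b = unit_fun u"
    by blast
  have "0 = (\<Sum>w\<in>unit_fun ` A. fun_scale (c w) w) u"
    using \<open>(\<Sum>w\<in>unit_fun ` A. fun_scale (c w) w) = 0\<close> by (simp only: zero_fun_apply)
  also have "\<dots> = (\<Sum>v\<in>A. c (unit_fun v) * unit_fun v u)"
    by (simp add: sum_fun_apply sum.reindex inj_on_subset[OF inj_unit_fun])
  also have "\<dots> = (\<Sum>v\<in>A. if v = u then c b else 0)"
    by (rule sum.cong) (auto simp: u unit_fun_def)
  also have "\<dots> = c b"
    using u by simp
  finally show "c b = 0" by simp
qed simp

lemma span_unit_fun:
  fixes A :: "'v::finite set"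
  shows "fvs.span (unit_fun ` A :: ('v \<Rightarrow> 'k::field) set) \<supseteq> coord_subspace A"
proof
  fix a :: "'v \<Rightarrow> 'k"
  assume a: "a \<in> coord_subspace A"
  have "a = (\<Sum>v\<in>A. fun_scale (a v) (unit_fun v))"
  proof
    fix u
    have "(\<Sum>v\<in>A. fun_scale (a v) (unit_fun v)) u = (\<Sum>v\<in>A. if v = u then a u else 0)"
      unfolding sum_fun_apply by (rule sum.cong) (auto simp: unit_fun_def)
    also have "\<dots> = a u"
      using a by (simp add: coord_subspace_def)
    finally show "a u = (\<Sum>v\<in>A. fun_scale (a v) (unit_fun v)) u" by simp
  qed
  also have "\<dots> \<in> fvs.span (unit_fun ` A)"
    by (intro fvs.span_sum fvs.span_scale fvs.span_base imageI)
  finally show "a \<in> fvs.span (unit_fun ` A)" .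
qed

interpretation ffvs: finite_dimensional_vector_space
  "fun_scale :: 'k::field \<Rightarrow> ('v::finite \<Rightarrow> 'k) \<Rightarrow> 'v \<Rightarrow> 'k" "range unit_fun"
proof unfold_locales
  show "fvs.span (range unit_fun) = (UNIV :: ('v \<Rightarrow> 'k) set)"
    using span_unit_fun[of UNIV] by (auto simp: coord_subspace_def)
qed (auto simp: independent_unit_fun)

lemma unit_fun_mem_coord_subspace: "u \<in> A \<Longrightarrow> unit_fun u \<in> coord_subspace A"
  by (auto simp: unit_fun_def coord_subspace_def)

lemma card_unit_fun: "card ((unit_fun :: 'v \<Rightarrow> 'v \<Rightarrow> 'k::zero_neq_one) ` A) = card A"
  by (rule card_image) (rule inj_on_subset[OF inj_unit_fun subset_UNIV])

lemma dim_coord_subspace: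
  fixes A :: "'v::finite set"
  shows "fvs.dim (coord_subspace A :: ('v \<Rightarrow> 'k::field) set) = card A"
  by (rule fvs.dim_unique[OF _ span_unit_fun independent_unit_fun card_unit_fun])
    (auto intro: unit_fun_mem_coord_subspace)

text \<open>Bounds the tangent space from below by exhibiting tangent unit vectors.\<close>

lemma card_le_dim_unit_fun:
  fixes A :: "'v::finite set" and T :: "('v \<Rightarrow> 'k::field) set"
  assumes "\<And>u. u \<in> A \<Longrightarrow> unit_fun u \<in> T"
  shows "card A \<le> fvs.dim T"
  using ffvs.independent_card_le_dim[of "unit_fun ` A" T] assms
  by (auto simp: independent_unit_fun card_unit_fun)

section \<open>Edge ideals and their smooth points\<close>

lemma monom_eval_edge:
  "monom_eval (Poly_Mapping.single i 1 + Poly_Mapping.single j 1) a = a i * a j"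
  by (simp add: monom_eval_add)

lemma edge_gens_image:
  "edge_gens E = (\<lambda>(i, j). Poly_Mapping.single (Poly_Mapping.single i 1 + Poly_Mapping.single j 1) 1)
    ` {(i, j). E i j}"
  by (auto simp: edge_gens_def)

lemma zset_edge_gens:
  "zset (edge_gens E) = {a :: 'v \<Rightarrow> 'k::comm_semiring_1. \<forall>u v. E u v \<longrightarrow> a u * a v = 0}"
  by (auto simp: zset_def edge_gens_image monom_eval_edge simp del: One_nat_def)

section \<open>Irreducible components of the edge variety\<close>

lemma vertex_cover_contains_min:
  fixes W :: "'v::finite set"
  assumes "vertex_cover E W"
  shows "\<exists>W'\<subseteq>W. min_vertex_cover E W'"
  using finite[of W] assms
proof (induction W rule: finite_psubset_induct)
  case (psubset W)
  show ?case
  proof (cases "min_vertex_cover E W")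
    case False
    then obtain W' where "W' \<subset> W" "vertex_cover E W'"
      using psubset.prems unfolding min_vertex_cover_def by blast
    moreover from this obtain W'' where "W'' \<subseteq> W'" "min_vertex_cover E W''"
      using psubset.IH[of W'] by auto
    ultimately show ?thesis
      by (intro exI[of _ W'']) auto
  qed auto
qed

lemma vertex_cover_zeros:
  fixes a :: "'v \<Rightarrow> 'k::semiring_no_zero_divisors"
  shows "vertex_cover E {v. a v = 0} \<longleftrightarrow> (\<forall>u v. E u v \<longrightarrow> a u * a v = 0)"
  by (simp add: vertex_cover_def)

lemma mem_coord_subspace_Compl: "a \<in> coord_subspace (- W) \<longleftrightarrow> W \<subseteq> {v. a v = 0}"
  by (auto simp: coord_subspace_def)

text \<open>The zero coordinates of a point of the variety form a vertex cover, which contains a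
  minimal one.\<close>

lemma zset_edge_gens_components:
  fixes E :: "'v::finite \<Rightarrow> 'v \<Rightarrow> bool"
  shows "zset (edge_gens E) =
    (\<Union>W\<in>{W. min_vertex_cover E W}. coord_subspace (- W) :: ('v \<Rightarrow> 'k::field) set)"
proof (intro set_eqI iffI)
  fix a :: "'v \<Rightarrow> 'k"
  assume "a \<in> zset (edge_gens E)"
  then have "vertex_cover E {v. a v = 0}"
    by (simp add: zset_edge_gens vertex_cover_zeros)
  then show "a \<in> (\<Union>W\<in>{W. min_vertex_cover E W}. coord_subspace (- W))"
    using vertex_cover_contains_min by (fastforce simp: mem_coord_subspace_Compl)
next
  fix a :: "'v \<Rightarrow> 'k"
  assume "a \<in> (\<Union>W\<in>{W. min_vertex_cover E W}. coord_subspace (- W))"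
  then obtain W where W: "vertex_cover E W" "W \<subseteq> {v. a v = 0}"
    by (auto simp: min_vertex_cover_def mem_coord_subspace_Compl)
  then have "vertex_cover E {v. a v = 0}"
    unfolding vertex_cover_def by blast
  then show "a \<in> zset (edge_gens E)"
    by (simp add: zset_edge_gens vertex_cover_zeros)
qed

text \<open>An irreducible subset lies in one of the finitely many coordinate subspaces. Each of
  these is maximal: an inclusion between two of them reverses to an inclusion of minimal covers,
  which is an equality.\<close>

lemma zcomponent_edge_gens_iff:
  fixes E :: "'v::finite \<Rightarrow> 'v \<Rightarrow> bool" and Y :: "('v \<Rightarrow> 'k::alg_closed_field) set"
  shows "zcomponent (zset (edge_gens E)) Y \<longleftrightarrow>
    (\<exists>W. min_vertex_cover E W \<and> Y = coord_subspace (- W))"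
proof -
  let ?X = "zset (edge_gens E) :: ('v \<Rightarrow> 'k) set"
  have le: "\<exists>W. min_vertex_cover E W \<and> Z \<subseteq> coord_subspace (- W)"
    if "zirreducible Z" "Z \<subseteq> ?X" for Z
    using zirreducible_subset_UN[OF that(1), of "{W. min_vertex_cover E W}" "\<lambda>W. coord_subspace (- W)"]
      that(2) zclosed_coord_subspace
    by (auto simp: zset_edge_gens_components)
  have ge: "coord_subspace (- W) \<subseteq> ?X" if "min_vertex_cover E W" for W
    using that by (auto simp: zset_edge_gens_components)
  show ?thesis
  proof
    assume Y: "zcomponent ?X Y"
    then obtain W where W: "min_vertex_cover E W" "Y \<subseteq> coord_subspace (- W)"
      using le unfolding zcomponent_def by blast
    then have "coord_subspace (- W) = Y"
      using Y ge zirreducible_coord_subspace unfolding zcomponent_def by blast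
    then show "\<exists>W. min_vertex_cover E W \<and> Y = coord_subspace (- W)"
      using W by blast
  next
    assume "\<exists>W. min_vertex_cover E W \<and> Y = coord_subspace (- W)"
    then obtain W where W: "min_vertex_cover E W" "Y = coord_subspace (- W)"
      by blast
    have "Y' = Y" if Y': "zirreducible Y'" "Y \<subseteq> Y'" "Y' \<subseteq> ?X" for Y'
    proof -
      obtain W' where W': "min_vertex_cover E W'" "Y' \<subseteq> coord_subspace (- W')"
        using le Y' by blast
      then have "(coord_subspace (- W) :: ('v \<Rightarrow> 'k) set) \<subseteq> coord_subspace (- W')"
        using Y' W by blast
      then have "W' \<subseteq> W"
        by (simp add: coord_subspace_subset_iff)
      then have "W' = W"
        using W W' unfolding min_vertex_cover_def by blast
      then show ?thesis
        using W W' Y' by blast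
    qed
    then show "zcomponent ?X Y"
      unfolding zcomponent_def using W ge zirreducible_coord_subspace by blast
  qed
qed

section \<open>Local dimension, tangent spaces and smooth points\<close>

lemma local_dim_edge_gens:
  fixes E :: "'v::finite \<Rightarrow> 'v \<Rightarrow> bool" and p :: "'v \<Rightarrow> 'k::alg_closed_field"
  shows "local_dim (zset (edge_gens E)) p =
    Sup ((\<lambda>W. enat (card (- W))) ` {W. min_vertex_cover E W \<and> W \<subseteq> {v. p v = 0}})"
proof -
  have "{Y. zcomponent (zset (edge_gens E)) Y \<and> p \<in> Y} =
      (\<lambda>W. coord_subspace (- W)) ` {W. min_vertex_cover E W \<and> W \<subseteq> {v. p v = 0}}"
    by (auto simp: zcomponent_edge_gens_iff mem_coord_subspace_Compl)
  then show ?thesis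
    by (simp add: local_dim_def setcompr_eq_image image_image zdim_coord_subspace)
qed

text \<open>The line through \<open>p\<close> in a direction \<open>w\<close> of the subspace stays
  in \<open>X\<close>, so every \<open>f\<close> vanishing on \<open>X\<close> has zero derivative
  along it.\<close>

lemma coord_subspace_subset_tangent_space:
  fixes p :: "'v \<Rightarrow> 'k::alg_closed_field"
  assumes "coord_subspace A \<subseteq> X" "p \<in> coord_subspace A"
  shows "coord_subspace A \<subseteq> tangent_space X p"
  unfolding tangent_space_def
proof (intro subsetI CollectI ballI)
  fix w :: "'v \<Rightarrow> 'k" and f
  assume w: "w \<in> coord_subspace A" and f: "f \<in> vanish X"
  have "(\<lambda>v. p v + t * w v) \<in> X" for t
    using w assms by (auto simp: coord_subspace_def)
  then have "{t. mpeval f (\<lambda>v. p v + t * w v) = 0} = UNIV"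
    using f by (auto simp: vanish_def)
  then show "mpdiff f p w = 0"
    using mpeval_zero_on_line(2)[of f p w] infinite_UNIV_alg_closed[where 'k = 'k] by simp
qed

text \<open>Edges at \<open>u\<close> stay covered by their other end, which differs from
  \<open>u\<close> as there are no loops.\<close>

lemma vertex_cover_remove:
  assumes "simple_graph E" "vertex_cover E W" "\<And>v. E u v \<Longrightarrow> v \<in> W"
  shows "vertex_cover E (W - {u})"
  using assms unfolding vertex_cover_def simple_graph_def by blast

text \<open>If \<open>p\<close> lies on the components of two minimal covers \<open>W\<close> and \<open>W'\<close>, the tangent space at \<open>p\<close>
  contains the sum of both components and is therefore too large for \<open>p\<close> to be smooth.\<close>

lemma smooth_point_edge_gensE:
  fixes E :: "'v::finite \<Rightarrow> 'v \<Rightarrow> bool" and p :: "'v \<Rightarrow> 'k::alg_closed_field"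
  assumes G: "simple_graph E" and p: "p \<in> smooth_points (zset (edge_gens E))"
  obtains W where "min_vertex_cover E W" "\<And>u. u \<in> W \<Longrightarrow> \<exists>v. E u v \<and> p v \<noteq> 0"
proof -
  let ?X = "zset (edge_gens E) :: ('v \<Rightarrow> 'k) set"
  let ?Ws = "{W. min_vertex_cover E W \<and> W \<subseteq> {v. p v = 0}}"
  let ?T = "tangent_space ?X p"
  have pX: "p \<in> ?X" and dim: "enat (fvs.dim ?T) = local_dim ?X p"
    using p by (auto simp: smooth_points_def)
  have cov: "vertex_cover E {v. p v = 0}"
    using pX by (simp add: zset_edge_gens vertex_cover_zeros)
  then have ne: "?Ws \<noteq> {}"
    using vertex_cover_contains_min by blast
  \<comment> \<open>The supremum is over a finite nonempty set, hence attained: some component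
    through \<open>p\<close> has the dimension of the tangent space.\<close>
  have "Sup ((\<lambda>W. enat (card (- W))) ` ?Ws) \<in> (\<lambda>W. enat (card (- W))) ` ?Ws"
    unfolding Sup_enat_def using ne by (simp only: image_is_empty if_False finite finite_imageI if_True) (intro Max_in, auto)
  then obtain W where W: "W \<in> ?Ws" "fvs.dim ?T = card (- W)"
    using dim unfolding local_dim_edge_gens by auto
  have tangent: "unit_fun u \<in> ?T" if "W' \<in> ?Ws" "u \<notin> W'" for u W'
  proof -
    have "coord_subspace (- W') \<subseteq> ?X" "p \<in> coord_subspace (- W')"
      using that by (auto simp: zset_edge_gens_components mem_coord_subspace_Compl)
    then show ?thesis
      using coord_subspace_subset_tangent_space unit_fun_mem_coord_subspace[of u "- W'"] that
      by blast
  qed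
  have sub: "W \<subseteq> W'" if "W' \<in> ?Ws" for W'
  proof
    fix u assume u: "u \<in> W"
    show "u \<in> W'"
    proof (rule ccontr)
      assume "u \<notin> W'"
      \<comment> \<open>Direction \<open>u\<close> is tangent along the component of
        \<open>W'\<close> and not among the directions outside \<open>W\<close>, so the tangent
        space would be too large.\<close>
      then have "card (insert u (- W)) \<le> fvs.dim ?T"
        using tangent[OF W(1)] tangent[OF that] by (intro card_le_dim_unit_fun) auto
      then show False
        using W(2) u by simp
    qed
  qed
  have "\<exists>v. E u v \<and> p v \<noteq> 0" if "u \<in> W" for u
  proof (rule ccontr)
    assume "\<not> ?thesis"
    then have "vertex_cover E ({v. p v = 0} - {u})"
      using vertex_cover_remove[OF G cov] by blast
    then obtain W' where "W' \<subseteq> {v. p v = 0} - {u}" "min_vertex_cover E W'"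
      using vertex_cover_contains_min by blast
    then show False
      using sub that by blast
  qed
  then show thesis
    using W that by blast
qed

lemma mpdiff_edge:
  fixes p :: "'v \<Rightarrow> 'k::comm_ring_1"
  assumes "u \<noteq> v"
  shows "mpdiff (Poly_Mapping.single (Poly_Mapping.single u 1 + Poly_Mapping.single v 1) 1) p w
    = w u * p v + w v * p u"
proof -
  have "Poly_Mapping.keys (Poly_Mapping.single u 1 + Poly_Mapping.single v (1::nat)) = {u, v}"
    by (auto simp: in_keys_iff lookup_add lookup_single when_def split: if_splits)
  moreover have "{u, v} - {u} = {v}" "{u, v} - {v} = {u}"
    using assms by auto
  ultimately show ?thesis
    using assms by (simp add: mpdiff_def lookup_add lookup_single)
qed

text \<open>By minimality each \<open>u \<in> W\<close> has a neighbour \<open>v\<close> outside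
  \<open>W\<close>. The differential of that edge monomial at \<open>p\<close> is
  \<open>w u * p v\<close> with \<open>p v \<noteq> 0\<close>, so \<open>w u = 0\<close> and the
  tangent space is no larger than the component.\<close>

lemma smooth_point_edge_gensI:
  fixes E :: "'v::finite \<Rightarrow> 'v \<Rightarrow> bool" and p :: "'v \<Rightarrow> 'k::alg_closed_field"
  assumes G: "simple_graph E" and W: "min_vertex_cover E W" and p: "{v. p v = 0} = W"
  shows "p \<in> smooth_points (zset (edge_gens E))"
proof -
  let ?X = "zset (edge_gens E) :: ('v \<Rightarrow> 'k) set"
  have "p \<in> coord_subspace (- W)" and WX: "coord_subspace (- W) \<subseteq> ?X"
    using p W by (auto simp: mem_coord_subspace_Compl zset_edge_gens_components)
  then have pX: "p \<in> ?X" and T1: "coord_subspace (- W) \<subseteq> tangent_space ?X p"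
    using coord_subspace_subset_tangent_space by blast+
  have "w u = 0" if w: "w \<in> tangent_space ?X p" and u: "u \<in> W" for w u
  proof -
    have "\<exists>v. E u v \<and> v \<notin> W"
    proof (rule ccontr)
      assume "\<not> ?thesis"
      then have "vertex_cover E (W - {u})"
        using vertex_cover_remove[OF G] W by (auto simp: min_vertex_cover_def)
      then show False
        using W u by (auto simp: min_vertex_cover_def)
    qed
    then obtain v where v: "E u v" "v \<notin> W"
      by blast
    let ?f = "Poly_Mapping.single (Poly_Mapping.single u 1 + Poly_Mapping.single v 1) 1 :: ('v, 'k) mpoly"
    have "u \<noteq> v"
      using u v by blast
    moreover have "?f \<in> edge_gens E"
      using v(1) by (auto simp: edge_gens_def)
    then have "?f \<in> vanish ?X"
      unfolding vanish_def zset_def by blast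
    then have "mpdiff ?f p w = 0"
      using w by (auto simp: tangent_space_def)
    moreover have "p u = 0" "p v \<noteq> 0"
      using p u v by auto
    ultimately show ?thesis
      by (simp add: mpdiff_edge del: One_nat_def)
  qed
  then have "tangent_space ?X p = coord_subspace (- W)"
    using T1 by (auto simp: coord_subspace_def)
  then have "fvs.dim (tangent_space ?X p) = card (- W)"
    by (simp add: dim_coord_subspace)
  \<comment> \<open>Minimality of \<open>W\<close> leaves a single component through
    \<open>p\<close>.\<close>
  moreover have "{W'. min_vertex_cover E W' \<and> W' \<subseteq> {v. p v = 0}} = {W}"
    using W by (auto simp: p min_vertex_cover_def)
  then have "local_dim ?X p = enat (card (- W))"
    by (simp add: local_dim_edge_gens)
  ultimately show ?thesis
    using pX by (simp add: smooth_points_def)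
qed

section \<open>Jets\<close>

text \<open>The Cauchy product of two truncated series; for \<open>l \<le> s\<close> the truncation
  has no effect.\<close>

lemma jet_coeff_edge:
  fixes q :: "'v \<times> nat \<Rightarrow> 'k::comm_ring_1"
  assumes "l \<le> s"
  shows "jet_coeff (Poly_Mapping.single (Poly_Mapping.single u 1 + Poly_Mapping.single v 1) 1) s l q
    = (\<Sum>i\<le>l. q (u, i) * q (v, l - i))"
proof -
  have co: "coeff (\<Sum>a\<le>s. monom (q (x, a)) a) i = q (x, i)" if "i \<le> s" for x i
  proof -
    have "coeff (\<Sum>a\<le>s. monom (q (x, a)) a) i = (\<Sum>a\<le>s. if a = i then q (x, i) else 0)"
      unfolding coeff_sum by (rule sum.cong) auto
    then show ?thesis
      using that by simp
  qed
  have "jet_coeff (Poly_Mapping.single (Poly_Mapping.single u 1 + Poly_Mapping.single v 1) 1) s l q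
    = coeff ((\<Sum>a\<le>s. monom (q (u, a)) a) * (\<Sum>a\<le>s. monom (q (v, a)) a)) l"
    by (simp add: jet_coeff_def monom_eval_edge pCons_one del: One_nat_def)
  also have "\<dots> = (\<Sum>i\<le>l. q (u, i) * q (v, l - i))"
    unfolding coeff_mult by (rule sum.cong) (use assms in \<open>auto simp: co\<close>)
  finally show ?thesis .
qed

lemma jet_scheme_edge_gens:
  fixes E :: "'v \<Rightarrow> 'v \<Rightarrow> bool"
  shows "jet_scheme (edge_gens E) s = {q :: 'v \<times> nat \<Rightarrow> 'k::comm_ring_1. q \<in> jet_space s \<and>
    (\<forall>u v. E u v \<longrightarrow> (\<forall>l\<le>s. (\<Sum>i\<le>l. q (u, i) * q (v, l - i)) = 0))}"
  by (auto simp: jet_scheme_def edge_gens_image jet_coeff_edge simp del: One_nat_def)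

text \<open>A truncated series with nonzero constant term is a unit: once the lower coefficients of
  \<open>x\<close> vanish, coefficient \<open>j\<close> of the product is
  \<open>x j * y 0\<close>.\<close>

lemma truncated_unit_cancel:
  fixes x y :: "nat \<Rightarrow> 'k::semiring_no_zero_divisors"
  assumes "\<And>l. l \<le> s \<Longrightarrow> (\<Sum>i\<le>l. x i * y (l - i)) = 0" "y 0 \<noteq> 0" "j \<le> s"
  shows "x j = 0"
  using assms(3)
proof (induction j rule: less_induct)
  case (less j)
  have "(\<Sum>i\<le>j. x i * y (j - i)) = (\<Sum>i<j. x i * y (j - i)) + x j * y 0"
    by (simp flip: lessThan_Suc_atMost)
  also have "(\<Sum>i<j. x i * y (j - i)) = 0"
    using less by (intro sum.neutral) auto
  finally show ?case
    using assms(1)[of j] assms(2) less.prems by simp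
qed

lemma zclosed_jet_cover_set: "zclosed (jet_cover_set W s :: ('v \<times> nat \<Rightarrow> 'k::field) set)"
proof -
  \<comment> \<open>The coordinates of order above \<open>s\<close> are set to zero as well, since
    points are functions on all of \<open>'v \<times> nat\<close>.\<close>
  have "(jet_cover_set W s :: ('v \<times> nat \<Rightarrow> 'k) set)
      = {a. \<forall>x\<in>{(i, l). s < l \<or> i \<in> W \<and> l \<le> s}. a x = 0}"
    by (auto simp: jet_cover_set_def jet_space_def)
  then show ?thesis
    by (simp only: zclosed_coords)
qed

lemma jet_over_smooth_point_mem_jet_cover_set:
  fixes E :: "'v::finite \<Rightarrow> 'v \<Rightarrow> bool" and q :: "'v \<times> nat \<Rightarrow> 'k::alg_closed_field"
  assumes "simple_graph E" and q: "q \<in> jet_scheme (edge_gens E) s"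
    and "jet_proj q \<in> smooth_points (zset (edge_gens E))"
  shows "\<exists>W. min_vertex_cover E W \<and> q \<in> jet_cover_set W s"
proof -
  obtain W where W: "min_vertex_cover E W"
      "\<And>u. u \<in> W \<Longrightarrow> \<exists>v. E u v \<and> jet_proj q v \<noteq> 0"
    using smooth_point_edge_gensE[OF assms(1,3)] by metis
  have "q (u, j) = 0" if u: "u \<in> W" and j: "j \<le> s" for u j
  proof -
    obtain v where v: "E u v" "q (v, 0) \<noteq> 0"
      using W(2)[OF u] by (auto simp: jet_proj_def)
    show ?thesis
      by (rule truncated_unit_cancel[of s "\<lambda>i. q (u, i)" "\<lambda>i. q (v, i)"])
        (use q v j in \<open>auto simp: jet_scheme_edge_gens\<close>)
  qed
  then show ?thesis
    using W(1) q by (auto simp: jet_cover_set_def jet_scheme_edge_gens)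
qed

text \<open>Every summand of an edge equation has a factor at an end in \<open>W\<close>, of order
  at most \<open>s\<close>.\<close>

lemma jet_cover_set_subset_jet_scheme:
  fixes E :: "'v \<Rightarrow> 'v \<Rightarrow> bool"
  assumes "vertex_cover E W"
  shows "jet_cover_set W s \<subseteq> (jet_scheme (edge_gens E) s :: ('v \<times> nat \<Rightarrow> 'k::comm_ring_1) set)"
proof
  fix q :: "'v \<times> nat \<Rightarrow> 'k"
  assume q: "q \<in> jet_cover_set W s"
  have "(\<Sum>i\<le>l. q (u, i) * q (v, l - i)) = 0" if "E u v" "l \<le> s" for u v l
  proof (rule sum.neutral, rule ballI)
    fix i assume "i \<in> {..l}"
    moreover have "u \<in> W \<or> v \<in> W"
      using assms that by (auto simp: vertex_cover_def)
    ultimately show "q (u, i) * q (v, l - i) = 0"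
      using q that by (auto simp: jet_cover_set_def)
  qed
  then show "q \<in> jet_scheme (edge_gens E) s"
    using q by (simp add: jet_scheme_edge_gens jet_cover_set_def)
qed

text \<open>Shifting the order-0 coordinates outside \<open>W\<close> by a common \<open>t\<close> moves a jet over a smooth point
  for all but finitely many \<open>t\<close>.\<close>

lemma jet_cover_set_subset_principal_component:
  fixes E :: "'v::finite \<Rightarrow> 'v \<Rightarrow> bool"
  assumes G: "simple_graph E" and W: "min_vertex_cover E W"
  shows "jet_cover_set W s \<subseteq> (principal_component E s :: ('v \<times> nat \<Rightarrow> 'k::alg_closed_field) set)"
proof
  fix q :: "'v \<times> nat \<Rightarrow> 'k"
  assume q: "q \<in> jet_cover_set W s"
  let ?S = "{p \<in> jet_scheme (edge_gens E) s. jet_proj p \<in> smooth_points (zset (edge_gens E))}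
    :: ('v \<times> nat \<Rightarrow> 'k) set"
  define e :: "'v \<times> nat \<Rightarrow> 'k" where "e = (\<lambda>(v, l). if v \<notin> W \<and> l = 0 then 1 else 0)"
  \<comment> \<open>The finitely many \<open>t\<close> for which some order-0 coordinate outside
    \<open>W\<close> becomes zero.\<close>
  let ?bad = "(\<lambda>v. - q (v, 0)) ` (- W)"
  have S: "(\<lambda>x. q x + t * e x) \<in> ?S" if t: "t \<notin> ?bad" for t
  proof -
    have "(\<lambda>x. q x + t * e x) \<in> jet_cover_set W s"
      using q by (auto simp: jet_cover_set_def jet_space_def e_def)
    then have "(\<lambda>x. q x + t * e x) \<in> jet_scheme (edge_gens E) s"
      using jet_cover_set_subset_jet_scheme W by (auto simp: min_vertex_cover_def)
    moreover have "q (v, 0) + t * e (v, 0) = 0 \<longleftrightarrow> v \<in> W" for v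
    proof (cases "v \<in> W")
      case True
      then show ?thesis
        using q by (simp add: jet_cover_set_def e_def)
    next
      case False
      then have "t \<noteq> - q (v, 0)"
        using t by blast
      then show ?thesis
        using False by (simp add: e_def eq_neg_iff_add_eq_0 add.commute)
    qed
    then have "jet_proj (\<lambda>x. q x + t * e x) \<in> smooth_points (zset (edge_gens E))"
      by (intro smooth_point_edge_gensI[OF G W]) (simp add: jet_proj_def)
    ultimately show ?thesis
      by simp
  qed
  have "mpeval f q = 0" if f: "f \<in> vanish ?S" for f
  proof (rule mpeval_zero_on_line(1))
    \<comment> \<open>Vanishing at cofinitely many points of the line forces vanishing at
      \<open>t = 0\<close>, which is \<open>q\<close>.\<close>
    have "- ?bad \<subseteq> {t. mpeval f (\<lambda>x. q x + t * e x) = 0}"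
      using S f unfolding vanish_def by blast
    moreover have "infinite (- ?bad)"
      using infinite_UNIV_alg_closed[where 'k = 'k] by (simp add: Compl_eq_Diff_UNIV)
    ultimately show "infinite {t. mpeval f (\<lambda>x. q x + t * e x) = 0}"
      using infinite_super by blast
  qed
  then show "q \<in> principal_component E s"
    by (simp add: principal_component_def zclosure_def zset_def)
qed

theorem mainTheorem6:
  fixes E :: "'v::finite \<Rightarrow> 'v \<Rightarrow> bool" and s :: nat
  assumes "simple_graph E" and "graph_connected E" and "\<exists>u v. E u v"
  shows "(principal_component E s :: ('v \<times> nat \<Rightarrow> 'k::alg_closed_field) set)
           = (\<Union>W\<in>{W. min_vertex_cover E W}. jet_cover_set W s)"
proof
  show "principal_component E s \<subseteq>
      (\<Union>W\<in>{W. min_vertex_cover E W}. jet_cover_set W s :: ('v \<times> nat \<Rightarrow> 'k) set)"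
    unfolding principal_component_def
  \<comment> \<open>The right-hand side is a finite union of closed sets, so it suffices that it
    contains the jets over smooth points.\<close>
  proof (rule zclosure_minimal)
    show "zclosed (\<Union>W\<in>{W. min_vertex_cover E W}. jet_cover_set W s :: ('v \<times> nat \<Rightarrow> 'k) set)"
      by (rule zclosed_UN) (auto intro: zclosed_jet_cover_set)
  qed (use jet_over_smooth_point_mem_jet_cover_set[OF assms(1)] in blast)
qed (use jet_cover_set_subset_principal_component[OF assms(1)] in blast)

end
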